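(* The sets $C_1,C_2,C_3,C_4$ are extreme subsets of $\overline{\mathbb H}\cap\mathbb R^4$. Moreover, the sets $\mathrm{conv}(C_1),\dots,\mathrm{conv}(C_4)$ are faces of $\mathrm{conv}(\overline{\mathbb H}\cap\mathbb R^4)$.
   Context: $\mathbb D$ is the open unit disc in $\mathbb C$, $\overline{\mathbb D}$ its closure. The tetrablock is $\mathbb E=\{(x_1,x_2,x_3)\in\mathbb C^3: 1-x_1z_1-x_2z_2+x_3z_1z_2\ne0 \text{ for all } z_1,z_2\in\overline{\mathbb D}\}$, with closure $\overline{\mathbb E}$ (for $x\in\overline{\mathbb E}$, $1-x_1z_1-x_2z_2+x_3z_1z_2\neq0$ for all $z_1,z_2\in\mathbb D$). For $(a,x_1,x_2,x_3)\in\mathbb C\times\overline{\mathbb E}$ and $z_1,z_2\in\mathbb D$ put $\psi_{z_1,z_2}(a,x_1,x_2,x_3)=\dfrac{a\sqrt{(1-|z_1|^2)(1-|z_2|^2)}}{1-x_1z_1-x_2z_2+x_3z_1z_2}$. The hexablock is $\mathbb H=\{(a,x_1,x_2,x_3)\in\mathbb C\times\mathbb E:\ \sup_{z_1,z_2\in\mathbb D}|\psi_{z_1,z_2}(a,x_1,x_2,x_3)|<1\}$, and $\overline{\mathbb H}$ is its closure in $\mathbb C^4$. The set $\mathbb E\cap\mathbb R^3$ is the open tetrahedron with vertices $(1,1,1)$, $(1,-1,-1)$, $(-1,1,-1)$, $(-1,-1,1)$ (known fact), and $\overline{\mathbb E}\cap\mathbb R^3$ is the closed tetrahedron. Its four (closed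 triangular) faces are $\Delta_1=\{x\in\overline{\mathbb E}\cap\mathbb R^3: -x_1+x_2-x_3+1=0\}$, $\Delta_2=\{x\in\overline{\mathbb E}\cap\mathbb R^3: -x_1-x_2+x_3+1=0\}$, $\Delta_3=\{x\in\overline{\mathbb E}\cap\mathbb R^3: x_1+x_2+x_3+1=0\}$, $\Delta_4=\{x\in\overline{\mathbb E}\cap\mathbb R^3: x_1-x_2-x_3+1=0\}$. For $1\le j\le4$, $$C_j=\{(a,x_1,x_2,x_3)\in\mathbb R\times\Delta_j:\ |\psi_{z_1,z_2}(a,x_1,x_2,x_3)|\le1\ \text{for all } z_1,z_2\in\mathbb D\}.$$ For a non-empty $K\subseteq\mathbb R^n$, a non-empty set $S\subseteq K$ is an extreme subset of $K$ if whenever $x,y\in K$, $0<t<1$ and $(1-t)x+ty\in S$, then $x\in S$ and $y\in S$. A face of a non-empty convex set $C\subseteq\mathbb R^n$ is a convex extreme subset of $C$. $\mathrm{conv}(S)$ is the convex hull of $S$. *)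

theory Defs
  imports "HOL-Analysis.Analysis"
begin

definition tetrablock :: "(complex \<times> complex \<times> complex) set" where
  "tetrablock = {(x1, x2, x3).
     \<forall>z1 \<in> cball 0 1. \<forall>z2 \<in> cball 0 1. 1 - x1 * z1 - x2 * z2 + x3 * z1 * z2 \<noteq> 0}"

text \<open>
  This is only used for \<open>z1, z2 \<in> ball 0 1\<close> and \<open>(x1, x2, x3) \<in> closure tetrablock\<close>,
  where the denominator does not vanish.
\<close>

fun psi :: "complex \<Rightarrow> complex \<Rightarrow> complex \<times> complex \<times> complex \<times> complex \<Rightarrow> complex" where
  "psi z1 z2 (a, x1, x2, x3) =
     a * complex_of_real (sqrt ((1 - (cmod z1)\<^sup>2) * (1 - (cmod z2)\<^sup>2)))
       / (1 - x1 * z1 - x2 * z2 + x3 * z1 * z2)"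

text \<open>The supremum is taken in \<open>ereal\<close>, so that it is meaningful without a boundedness proof.\<close>

definition hexablock :: "(complex \<times> complex \<times> complex \<times> complex) set" where
  "hexablock = {(a, x). x \<in> tetrablock \<and>
     (SUP (z1, z2) \<in> ball 0 1 \<times> ball 0 1. ereal (cmod (psi z1 z2 (a, x)))) < 1}"

fun complexify3 :: "real \<times> real \<times> real \<Rightarrow> complex \<times> complex \<times> complex" where
  "complexify3 (x1, x2, x3) = (of_real x1, of_real x2, of_real x3)"

fun complexify4 :: "real \<times> real \<times> real \<times> real \<Rightarrow> complex \<times> complex \<times> complex \<times> complex" where
  "complexify4 (a, x) = (of_real a, complexify3 x)"

text \<open>The intersections with \<open>\<real>\<^sup>3\<close> and \<open>\<real>\<^sup>4\<close>, as subsets of the real spaces.\<close>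

definition real_closed_tetrablock :: "(real \<times> real \<times> real) set" where
  "real_closed_tetrablock = {x. complexify3 x \<in> closure tetrablock}"

definition real_closed_hexablock :: "(real \<times> real \<times> real \<times> real) set" where
  "real_closed_hexablock = {y. complexify4 y \<in> closure hexablock}"

definition Delta1 :: "(real \<times> real \<times> real) set" where
  "Delta1 = {(x1, x2, x3). (x1, x2, x3) \<in> real_closed_tetrablock \<and> - x1 + x2 - x3 + 1 = 0}"

definition Delta2 :: "(real \<times> real \<times> real) set" where
  "Delta2 = {(x1, x2, x3). (x1, x2, x3) \<in> real_closed_tetrablock \<and> - x1 - x2 + x3 + 1 = 0}"

definition Delta3 :: "(real \<times> real \<times> real) set" where
  "Delta3 = {(x1, x2, x3). (x1, x2, x3) \<in> real_closed_tetrablock \<and> x1 + x2 + x3 + 1 = 0}"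

definition Delta4 :: "(real \<times> real \<times> real) set" where
  "Delta4 = {(x1, x2, x3). (x1, x2, x3) \<in> real_closed_tetrablock \<and> x1 - x2 - x3 + 1 = 0}"

text \<open>\<open>C_over Delta1\<close>, \dots, \<open>C_over Delta4\<close> are the sets \<open>C\<^sub>1\<close>, \dots, \<open>C\<^sub>4\<close>.\<close>

definition C_over :: "(real \<times> real \<times> real) set \<Rightarrow> (real \<times> real \<times> real \<times> real) set" where
  "C_over \<Delta> = {(a, x). x \<in> \<Delta> \<and>
     (\<forall>z1 \<in> ball 0 1. \<forall>z2 \<in> ball 0 1. cmod (psi z1 z2 (complexify4 (a, x))) \<le> 1)}"

definition extreme_subset :: "'a::real_vector set \<Rightarrow> 'a set \<Rightarrow> bool" where
  "extreme_subset S K \<longleftrightarrow> S \<noteq> {} \<and> S \<subseteq> K \<and>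
     (\<forall>x\<in>K. \<forall>y\<in>K. \<forall>t. 0 < t \<and> t < 1 \<and> (1 - t) *\<^sub>R x + t *\<^sub>R y \<in> S \<longrightarrow> x \<in> S \<and> y \<in> S)"

text \<open>
  A face is a convex extreme subset; this is \<open>face_of\<close> together with nonemptiness
  (\<open>face_of\<close> also admits the empty face).
\<close>

lemma convex_extreme_subset_iff_face_of:
  "convex F \<and> extreme_subset F K \<longleftrightarrow> F face_of K \<and> F \<noteq> {}"
proof
  assume "convex F \<and> extreme_subset F K"
  then show "F face_of K \<and> F \<noteq> {}"
    unfolding extreme_subset_def face_of_def in_segment by blast
next
  assume F: "F face_of K \<and> F \<noteq> {}"
  have "x \<in> F \<and> y \<in> F"
    if "x \<in> K" "y \<in> K" "0 < t" "t < 1" "(1 - t) *\<^sub>R x + t *\<^sub>R y \<in> F" for x y t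
  proof (cases "x = y")
    case True
    then show ?thesis
      using that(5) by (simp flip: scaleR_left_distrib)
  next
    case False
    then have "(1 - t) *\<^sub>R x + t *\<^sub>R y \<in> open_segment x y"
      using that(3,4) unfolding in_segment by blast
    then show ?thesis
      using F that unfolding face_of_def by blast
  qed
  then show "convex F \<and> extreme_subset F K"
    using F unfolding extreme_subset_def face_of_def by blast
qed

end

theory Submission
  imports Defs
begin

text \<open>
  Write \<open>P(z, w) = 1 - x\<^sub>1 z - x\<^sub>2 w + x\<^sub>3 z w\<close>. Each \<open>\<Delta>\<^sub>j\<close> is cut out of the real closed
  tetrablock by the equation \<open>P(s, t) = 0\<close> for one of the four sign pairs
  \<open>s, t \<in> {-1, 1}\<close>. For a point of the closed tetrablock, \<open>P\<close> has no zero in the open bidisc;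
  for a real point it is therefore positive on the real square \<open>(-1, 1)\<^sup>2\<close>, where it is real and
  takes the value \<open>1\<close> at the origin. In the limit \<open>P(s, t) \<ge> 0\<close>, so the hyperplane
  \<open>P(s, t) = 0\<close> supports the real closed hexablock.

  The closed hexablock consists of the points \<open>(a, x)\<close> with \<open>x\<close> in the closed tetrablock
  and \<open>|\<psi>\<^sub>z\<^sub>,\<^sub>w(a, x)| \<le> 1\<close> on the open bidisc (\<open>closure_hexablock_iff\<close>). Hence \<open>C\<^sub>j\<close> is exactly the
  intersection of the real closed hexablock with its supporting hyperplane. Such an intersection
  is always an extreme subset, and its convex hull is the intersection of the full convex
  hull with the same hyperplane, which is a face.
\<close>

section \<open>Supporting hyperplanes of sets that need not be convex\<close>

lemma extreme_subset_supporting_hyperplane: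
  fixes S :: "'a::real_inner set"
  assumes "\<And>x. x \<in> S \<Longrightarrow> c \<le> u \<bullet> x" and "S \<inter> {x. u \<bullet> x = c} \<noteq> {}"
  shows "extreme_subset (S \<inter> {x. u \<bullet> x = c}) S"
proof -
  have "u \<bullet> x = c \<and> u \<bullet> y = c"
    if xy: "x \<in> S" "y \<in> S" and t: "0 < t" "t < 1"
      and c: "u \<bullet> ((1 - t) *\<^sub>R x + t *\<^sub>R y) = c" for x y t
  proof -
    \<comment> \<open>Both summands are nonnegative, so both vanish.\<close>
    have "(1 - t) * (u \<bullet> x - c) + t * (u \<bullet> y - c) = 0"
      using c by (simp add: inner_add_right algebra_simps)
    moreover have "0 \<le> (1 - t) * (u \<bullet> x - c)" "0 \<le> t * (u \<bullet> y - c)"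
      using assms(1) xy t by simp_all
    ultimately have "(1 - t) * (u \<bullet> x - c) = 0" "t * (u \<bullet> y - c) = 0"
      by linarith+
    then show ?thesis
      using t by simp
  qed
  then show ?thesis
    using assms(2) unfolding extreme_subset_def by blast
qed

text \<open>
  The open half-space on the positive side of the hyperplane, together with the hull of the
  contact set, forms a convex set: a proper convex combination with a strictly
  positive point is strictly positive. This set contains \<open>S\<close>, hence the whole hull.
\<close>

lemma convex_hull_Int_supporting_hyperplane:
  fixes S :: "'a::real_inner set"
  assumes ge: "\<And>x. x \<in> S \<Longrightarrow> c \<le> u \<bullet> x"
  shows "convex hull (S \<inter> {x. u \<bullet> x = c}) = convex hull S \<inter> {x. u \<bullet> x = c}"
proof
  have "convex hull (S \<inter> {x. u \<bullet> x = c}) \<subseteq> {x. u \<bullet> x = c}"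
    by (rule hull_minimal) (auto simp: convex_hyperplane)
  then show "convex hull (S \<inter> {x. u \<bullet> x = c}) \<subseteq> convex hull S \<inter> {x. u \<bullet> x = c}"
    by (simp add: hull_mono)
next
  let ?H = "convex hull (S \<inter> {x. u \<bullet> x = c})"
  let ?T = "{x. c < u \<bullet> x} \<union> ?H"
  have H_eq: "u \<bullet> x = c" if "x \<in> ?H" for x
  proof -
    have "?H \<subseteq> {x. u \<bullet> x = c}"
      by (rule hull_minimal) (auto simp: convex_hyperplane)
    then show ?thesis
      using that by auto
  qed
  have "convex ?T"
  proof (rule convex_alt[THEN iffD2], intro ballI allI impI)
    fix x y and t :: real
    assume x: "x \<in> ?T" and y: "y \<in> ?T" and "0 \<le> t \<and> t \<le> 1"
    then consider "t = 0" | "t = 1" | "0 < t" "t < 1"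
      by linarith
    then show "(1 - t) *\<^sub>R x + t *\<^sub>R y \<in> ?T"
    proof cases
      case 3
      show ?thesis
      proof (cases "x \<in> ?H \<and> y \<in> ?H")
        case True
        then show ?thesis
          using 3 convex_convex_hull[of "S \<inter> {x. u \<bullet> x = c}"] by (simp add: convex_alt)
      next
        case False
        have nonneg: "0 \<le> u \<bullet> x - c" "0 \<le> u \<bullet> y - c"
          using x y H_eq by force+
        have pos: "0 < u \<bullet> x - c \<or> 0 < u \<bullet> y - c"
          using False x y by auto
        have "0 < (1 - t) * (u \<bullet> x - c) + t * (u \<bullet> y - c)"
          using pos nonneg 3 by (auto intro: add_pos_nonneg add_nonneg_pos)
        then show ?thesis
          by (simp add: inner_add_right algebra_simps)
      qed
    qed (use x y in simp_all)
  qed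
  moreover have "S \<subseteq> ?T"
    using ge hull_subset[of "S \<inter> {x. u \<bullet> x = c}" convex] by force
  ultimately have "convex hull S \<subseteq> ?T"
    by (simp add: hull_minimal)
  then show "convex hull S \<inter> {x. u \<bullet> x = c} \<subseteq> ?H"
    by auto
qed

lemma convex_hull_face_of_supporting_hyperplane:
  fixes S :: "'a::euclidean_space set"
  assumes ge: "\<And>x. x \<in> S \<Longrightarrow> c \<le> u \<bullet> x"
  shows "convex hull (S \<inter> {x. u \<bullet> x = c}) face_of convex hull S"
proof -
  have "convex hull S \<subseteq> {x. c \<le> u \<bullet> x}"
    by (rule hull_minimal) (use ge in \<open>auto simp: convex_halfspace_ge\<close>)
  then have "convex hull S \<inter> {x. u \<bullet> x = c} face_of convex hull S"
    by (intro face_of_Int_supporting_hyperplane_ge) auto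
  then show ?thesis
    by (simp add: convex_hull_Int_supporting_hyperplane[OF ge])
qed

section \<open>The closed tetrablock\<close>

text \<open>
  The zero of \<open>P(z, w)\<close> in \<open>z\<close> is \<open>(1 - x\<^sub>2 w) / (x\<^sub>1 - x\<^sub>3 w)\<close>, and it has to lie outside the closed disc.
  Unlike the nonvanishing of \<open>P\<close>, the resulting inequalities survive passage to the closure.
\<close>

lemma tetrablock_bounds:
  assumes "(x1, x2, x3) \<in> tetrablock" and "cmod w \<le> 1"
  shows "cmod x2 \<le> 1" and "cmod (x1 - x3 * w) \<le> cmod (1 - x2 * w)"
proof -
  have nz: "1 - x1 * z - x2 * w + x3 * z * w \<noteq> 0" if "cmod z \<le> 1" "cmod w \<le> 1" for z w
    using assms(1) that unfolding tetrablock_def by auto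
  show "cmod x2 \<le> 1"
  proof (rule ccontr)
    assume "\<not> cmod x2 \<le> 1"
    then have "x2 \<noteq> 0" "cmod (1 / x2) \<le> 1"
      by (auto simp: norm_divide divide_simps)
    then show False
      using nz[of 0 "1 / x2"] by simp
  qed
  show "cmod (x1 - x3 * w) \<le> cmod (1 - x2 * w)"
  proof (rule ccontr)
    assume *: "\<not> cmod (x1 - x3 * w) \<le> cmod (1 - x2 * w)"
    define z where "z = (1 - x2 * w) / (x1 - x3 * w)"
    have ne: "x1 - x3 * w \<noteq> 0"
      using * by auto
    then have "cmod z \<le> 1"
      using * by (simp add: z_def norm_divide divide_simps)
    moreover have "z * (x1 - x3 * w) = 1 - x2 * w"
      using ne by (simp add: z_def)
    ultimately show False
      using nz[of z w] assms(2) by (simp add: algebra_simps)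
  qed
qed

lemma closure_tetrablock_bounds:
  assumes "(x1, x2, x3) \<in> closure tetrablock" and "cmod w \<le> 1"
  shows "cmod x2 \<le> 1" and "cmod (x1 - x3 * w) \<le> cmod (1 - x2 * w)"
proof -
  let ?B = "{x. cmod (fst (snd x)) \<le> 1 \<and>
              cmod (fst x - snd (snd x) * w) \<le> cmod (1 - fst (snd x) * w)}"
  have "closed ?B"
    by (intro closed_Collect_conj closed_Collect_le continuous_intros)
  moreover have "tetrablock \<subseteq> ?B"
    using tetrablock_bounds[OF _ assms(2)] by auto
  ultimately have "closure tetrablock \<subseteq> ?B"
    by (rule closure_minimal[rotated])
  then show "cmod x2 \<le> 1" "cmod (x1 - x3 * w) \<le> cmod (1 - x2 * w)"
    using assms(1) by auto
qed

lemma closure_tetrablock_nonzero: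
  assumes x: "(x1, x2, x3) \<in> closure tetrablock" and z: "cmod z < 1" and w: "cmod w < 1"
  shows "1 - x1 * z - x2 * w + x3 * z * w \<noteq> 0"
proof
  assume "1 - x1 * z - x2 * w + x3 * z * w = 0"
  then have eq: "z * (x1 - x3 * w) = 1 - x2 * w"
    by (simp add: algebra_simps)
  have "cmod (x2 * w) < 1"
    using mult_right_mono[OF closure_tetrablock_bounds(1)[OF x, of w], of "cmod w"] w
    by (simp add: norm_mult)
  then have pos: "0 < cmod (1 - x2 * w)"
    by auto
  have "cmod (1 - x2 * w) = cmod z * cmod (x1 - x3 * w)"
    by (simp flip: eq add: norm_mult)
  also have "\<dots> \<le> cmod z * cmod (1 - x2 * w)"
    using closure_tetrablock_bounds(2)[OF x] w by (intro mult_left_mono) auto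
  also have "\<dots> < cmod (1 - x2 * w)"
    using pos z by simp
  finally show False
    by simp
qed

text \<open>
  Replacing \<open>(x\<^sub>1, x\<^sub>2, x\<^sub>3)\<close> by \<open>(r x\<^sub>1, r x\<^sub>2, r\<^sup>2 x\<^sub>3)\<close> amounts to evaluating \<open>P\<close> at \<open>(r z, r w)\<close>, which
  moves the closed bidisc into the open one.
\<close>

lemma tetrablock_scaled:
  assumes nz: "\<And>z w. cmod z < 1 \<Longrightarrow> cmod w < 1 \<Longrightarrow> 1 - x1 * z - x2 * w + x3 * z * w \<noteq> 0"
    and r: "0 < r" "r < 1"
  shows "(of_real r * x1, of_real r * x2, (of_real r)\<^sup>2 * x3) \<in> tetrablock"
proof -
  have "1 - of_real r * x1 * z - of_real r * x2 * w + (of_real r)\<^sup>2 * x3 * z * w \<noteq> 0"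
    if "cmod z \<le> 1" "cmod w \<le> 1" for z w
  proof -
    have "r * cmod z \<le> r" "r * cmod w \<le> r"
      using that r by (simp_all add: mult_left_le)
    then have "cmod (of_real r * z) < 1" "cmod (of_real r * w) < 1"
      using r unfolding norm_mult norm_of_real by linarith+
    from nz[OF this] show ?thesis
      by (simp add: power2_eq_square algebra_simps)
  qed
  then show ?thesis
    unfolding tetrablock_def by auto
qed

text \<open>The case \<open>a = 0\<close> of this limit also serves the tetrablock.\<close>

lemma tendsto_scaled:
  fixes a x1 x2 x3 :: complex
  shows "((\<lambda>r. (of_real r * a, of_real r * x1, of_real r * x2, (of_real r)\<^sup>2 * x3))
          \<longlongrightarrow> (a, x1, x2, x3)) (at_left 1)"
proof -
  have "((\<lambda>r. (of_real r * a, of_real r * x1, of_real r * x2, (of_real r)\<^sup>2 * x3))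
          \<longlongrightarrow> (of_real 1 * a, of_real 1 * x1, of_real 1 * x2, (of_real 1)\<^sup>2 * x3)) (at_left 1)"
    by (intro tendsto_intros)
  then show ?thesis
    by simp
qed

lemma eventually_at_left_one: "\<forall>\<^sub>F r in at_left (1::real). 0 < r \<and> r < 1"
  using eventually_at_left_real[of 0 "1::real"] by (auto elim: eventually_mono)

lemma in_closure_tetrablock:
  assumes "\<And>z w. cmod z < 1 \<Longrightarrow> cmod w < 1 \<Longrightarrow> 1 - x1 * z - x2 * w + x3 * z * w \<noteq> 0"
  shows "(x1, x2, x3) \<in> closure tetrablock"
proof (rule Lim_in_closed_set[OF closed_closure])
  show "\<forall>\<^sub>F r in at_left 1.
          (of_real r * x1, of_real r * x2, (of_real r)\<^sup>2 * x3) \<in> closure tetrablock"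
    using eventually_at_left_one
    by eventually_elim (use tetrablock_scaled[OF assms] closure_subset in blast)
  show "((\<lambda>r. (of_real r * x1, of_real r * x2, (of_real r)\<^sup>2 * x3))
          \<longlongrightarrow> (x1, x2, x3)) (at_left 1)"
    using tendsto_snd[OF tendsto_scaled[of 0 x1 x2 x3]] by simp
qed simp

section \<open>The closed hexablock\<close>

lemma psi_le_1_iff:
  assumes x: "(x1, x2, x3) \<in> closure tetrablock" and "cmod z < 1" "cmod w < 1"
  shows "cmod (psi z w (a, x1, x2, x3)) \<le> 1 \<longleftrightarrow>
    cmod a * sqrt ((1 - (cmod z)\<^sup>2) * (1 - (cmod w)\<^sup>2)) \<le> cmod (1 - x1 * z - x2 * w + x3 * z * w)"
proof -
  have "0 < cmod (1 - x1 * z - x2 * w + x3 * z * w)"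
    using closure_tetrablock_nonzero[OF assms] by simp
  moreover have "0 \<le> (1 - (cmod z)\<^sup>2) * (1 - (cmod w)\<^sup>2)"
    using assms(2,3) by (intro mult_nonneg_nonneg) (simp_all add: abs_square_le_1)
  ultimately show ?thesis
    by (simp add: norm_mult norm_divide divide_le_eq_1)
qed

lemma hexablock_scaled:
  assumes x: "(x1, x2, x3) \<in> closure tetrablock"
    and psi: "\<And>z w. cmod z < 1 \<Longrightarrow> cmod w < 1 \<Longrightarrow> cmod (psi z w (a, x1, x2, x3)) \<le> 1"
    and r: "0 < r" "r < 1"
  shows "(of_real r * a, of_real r * x1, of_real r * x2, (of_real r)\<^sup>2 * x3) \<in> hexablock"
proof -
  let ?x = "(of_real r * x1, of_real r * x2, (of_real r)\<^sup>2 * x3)"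
  have E: "?x \<in> tetrablock"
    using closure_tetrablock_nonzero[OF x] r by (rule tetrablock_scaled)
  have "cmod (psi z w (of_real r * a, ?x)) \<le> r" if z: "cmod z < 1" and w: "cmod w < 1" for z w
  proof -
    let ?d = "\<lambda>z w. sqrt ((1 - (cmod z)\<^sup>2) * (1 - (cmod w)\<^sup>2))"
    let ?z = "of_real r * z" and ?w = "of_real r * w"
    let ?P = "1 - x1 * ?z - x2 * ?w + x3 * ?z * ?w"
    have small: "cmod ?z \<le> cmod z" "cmod ?w \<le> cmod w"
      using r by (simp_all add: norm_mult mult_left_le_one_le)
    then have lt: "cmod ?z < 1" "cmod ?w < 1"
      using z w by linarith+
    have sq: "(cmod ?z)\<^sup>2 \<le> (cmod z)\<^sup>2" "(cmod ?w)\<^sup>2 \<le> (cmod w)\<^sup>2"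
      using small by (simp_all add: power_mono)
    have le1: "(cmod z)\<^sup>2 \<le> 1" "(cmod w)\<^sup>2 \<le> 1"
      using z w by (simp_all add: abs_square_le_1)
    \<comment> \<open>Moving towards the origin can only enlarge the weight in the numerator.\<close>
    have "?d z w \<le> ?d ?z ?w"
      unfolding real_sqrt_le_iff using sq le1 by (intro mult_mono) linarith+
    then have "cmod a * ?d z w \<le> cmod a * ?d ?z ?w"
      by (rule mult_left_mono) simp
    also have "\<dots> \<le> cmod ?P"
      using psi[OF lt] psi_le_1_iff[OF x lt] by blast
    finally have "cmod a * ?d z w \<le> cmod ?P" .
    moreover have "0 < cmod ?P"
      using closure_tetrablock_nonzero[OF x lt] by simp
    ultimately have le: "cmod a * ?d z w / cmod ?P \<le> 1"
      by simp
    have P: "1 - of_real r * x1 * z - of_real r * x2 * w + (of_real r)\<^sup>2 * x3 * z * w = ?P"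
      by (simp add: power2_eq_square algebra_simps)
    have "0 \<le> ?d z w"
      using le1 by simp
    then have "cmod (psi z w (of_real r * a, ?x)) = r * (cmod a * ?d z w / cmod ?P)"
      using r unfolding psi.simps P norm_divide norm_mult norm_of_real by simp
    also have "\<dots> \<le> r"
      using le r by (intro mult_left_le) simp_all
    finally show ?thesis .
  qed
  then have "(SUP (z, w) \<in> ball 0 1 \<times> ball 0 1. ereal (cmod (psi z w (of_real r * a, ?x)))) \<le> ereal r"
    by (intro SUP_least) auto
  also have "\<dots> < 1"
    using r by simp
  finally show ?thesis
    using E unfolding hexablock_def by simp
qed

text \<open>
  Multiplied out as in \<open>psi_le_1_iff\<close>, the bound on \<open>\<psi>\<close> is a closed condition, so it
  passes from the hexablock to its closure. Conversely, a point with this bound is the limit for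
  \<open>r \<rightarrow> 1\<close> of the scaled points of \<open>hexablock_scaled\<close>, whose values \<open>|\<psi>|\<close> are bounded by \<open>r < 1\<close>.
\<close>

theorem closure_hexablock_iff:
  "(a, x) \<in> closure hexablock \<longleftrightarrow>
     x \<in> closure tetrablock \<and> (\<forall>z\<in>ball 0 1. \<forall>w\<in>ball 0 1. cmod (psi z w (a, x)) \<le> 1)"
  (is "_ \<longleftrightarrow> ?R a x")
proof
  let ?ineq = "\<lambda>z w y. cmod (fst y) * sqrt ((1 - (cmod z)\<^sup>2) * (1 - (cmod w)\<^sup>2))
    \<le> cmod (1 - fst (snd y) * z - fst (snd (snd y)) * w + snd (snd (snd y)) * z * w)"
  let ?B = "UNIV \<times> closure tetrablock \<inter> (\<Inter>z\<in>ball 0 1. \<Inter>w\<in>ball 0 1. Collect (?ineq z w))"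
  have R: "(b, y) \<in> ?B \<longleftrightarrow> ?R b y" for b y
    by (cases y) (auto simp: psi_le_1_iff simp del: psi.simps)
  have "closed ?B"
    by (intro closed_Int closed_Times closed_INT ballI closed_Collect_le
        closed_UNIV closed_closure continuous_intros)
  moreover have "hexablock \<subseteq> ?B"
  proof (rule subrelI)
    fix b y
    assume "(b, y) \<in> hexablock"
    then have y: "y \<in> tetrablock"
      and sup: "(SUP (z, w) \<in> ball 0 1 \<times> ball 0 1. ereal (cmod (psi z w (b, y)))) < 1"
      unfolding hexablock_def by auto
    have "cmod (psi z w (b, y)) \<le> 1" if "z \<in> ball 0 1" "w \<in> ball 0 1" for z w
    proof -
      have "ereal (cmod (psi z w (b, y)))
              \<le> (SUP (z, w) \<in> ball 0 1 \<times> ball 0 1. ereal (cmod (psi z w (b, y))))"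
        using that by (intro SUP_upper2[of "(z, w)"]) auto
      also note sup
      finally show ?thesis
        by simp
    qed
    then show "(b, y) \<in> ?B"
      using y closure_subset unfolding R by blast
  qed
  ultimately have "closure hexablock \<subseteq> ?B"
    by (rule closure_minimal[rotated])
  moreover assume "(a, x) \<in> closure hexablock"
  ultimately show "?R a x"
    using R by blast
next
  assume R: "?R a x"
  obtain x1 x2 x3 where x: "x = (x1, x2, x3)"
    by (cases x)
  show "(a, x) \<in> closure hexablock"
    unfolding x
  proof (rule Lim_in_closed_set[OF closed_closure _ _ tendsto_scaled])
    show "\<forall>\<^sub>F r in at_left 1.
        (of_real r * a, of_real r * x1, of_real r * x2, (of_real r)\<^sup>2 * x3) \<in> closure hexablock"
      using eventually_at_left_one
    proof eventually_elim
      case (elim r)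
      have "(of_real r * a, of_real r * x1, of_real r * x2, (of_real r)\<^sup>2 * x3) \<in> hexablock"
        using R elim unfolding x by (intro hexablock_scaled) auto
      then show ?case
        using closure_subset by blast
    qed
  qed simp
qed

section \<open>The four faces\<close>

text \<open>
  On the segment from the origin to a corner \<open>(s, t)\<close> of the real square, the polynomial is real,
  has no zero before the corner and starts with the value \<open>1\<close>.
\<close>

lemma real_closed_tetrablock_corner:
  assumes x: "(x1, x2, x3) \<in> real_closed_tetrablock" and st: "\<bar>s\<bar> = 1" "\<bar>t\<bar> = 1"
  shows "0 \<le> 1 - s * x1 - t * x2 + s * t * x3"
proof (rule ccontr)
  let ?p = "\<lambda>r. 1 - r * s * x1 - r * t * x2 + r * s * (r * t) * x3"
  assume neg: "\<not> 0 \<le> 1 - s * x1 - t * x2 + s * t * x3"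
  then have neg': "?p 1 < 0"
    by simp
  have "continuous_on {0..1} ?p"
    by (intro continuous_intros)
  then obtain r where r: "0 \<le> r" "r \<le> 1" "?p r = 0"
    using IVT2'[of ?p 1 0 0] neg' by auto
  then have "r < 1"
    using neg' by (cases "r = 1") auto
  then have "1 - of_real x1 * of_real (r * s) - of_real x2 * of_real (r * t)
      + of_real x3 * of_real (r * s) * of_real (r * t) \<noteq> (0::complex)"
    using x st r(1) unfolding real_closed_tetrablock_def
    by (intro closure_tetrablock_nonzero) (auto simp: norm_mult)
  moreover have "1 - of_real x1 * of_real (r * s) - of_real x2 * of_real (r * t)
      + of_real x3 * of_real (r * s) * of_real (r * t) = complex_of_real (?p r)"
    by (simp add: algebra_simps)
  ultimately show False
    using r(3) by simp
qed

definition corner_face :: "real \<Rightarrow> real \<Rightarrow> (real \<times> real \<times> real) set" where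
  "corner_face s t =
     {(x1, x2, x3). (x1, x2, x3) \<in> real_closed_tetrablock \<and> 1 - s * x1 - t * x2 + s * t * x3 = 0}"

lemma Delta_eq_corner_face:
  "Delta1 = corner_face 1 (-1)" "Delta2 = corner_face 1 1"
  "Delta3 = corner_face (-1) (-1)" "Delta4 = corner_face (-1) 1"
  unfolding Delta1_def Delta2_def Delta3_def Delta4_def corner_face_def by auto

lemma inner_corner:
  fixes a x1 x2 x3 s t :: real
  shows "(0, - s, - t, s * t) \<bullet> (a, x1, x2, x3) = - s * x1 - t * x2 + s * t * x3"
  by simp

lemma C_over_corner_face:
  "C_over (corner_face s t) = real_closed_hexablock \<inter> {y. (0, - s, - t, s * t) \<bullet> y = - 1}"
proof -
  have "(a, x1, x2, x3) \<in> C_over (corner_face s t) \<longleftrightarrow>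
    (a, x1, x2, x3) \<in> real_closed_hexablock \<inter> {y. (0, - s, - t, s * t) \<bullet> y = - 1}"
    for a x1 x2 x3
    unfolding C_over_def corner_face_def real_closed_hexablock_def real_closed_tetrablock_def
    by (auto simp: closure_hexablock_iff simp del: psi.simps)
  then show ?thesis
    by auto
qed

lemma real_closed_hexablock_supported:
  assumes y: "y \<in> real_closed_hexablock" and st: "\<bar>s\<bar> = 1" "\<bar>t\<bar> = 1"
  shows "- 1 \<le> (0, - s, - t, s * t) \<bullet> y"
proof -
  obtain a x1 x2 x3 where eq: "y = (a, x1, x2, x3)"
    by (cases y)
  then have "(x1, x2, x3) \<in> real_closed_tetrablock"
    using y unfolding real_closed_hexablock_def real_closed_tetrablock_def
    by (auto simp: closure_hexablock_iff simp del: psi.simps)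
  from real_closed_tetrablock_corner[OF this st] show ?thesis
    unfolding eq inner_corner by linarith
qed

text \<open>At the vertex \<open>(s, t, s t)\<close> the polynomial factors as \<open>(1 - s z) (1 - t w)\<close>.\<close>

lemma C_over_corner_face_nonempty:
  assumes st: "\<bar>s\<bar> = 1" "\<bar>t\<bar> = 1"
  shows "C_over (corner_face s t) \<noteq> {}"
proof -
  have "1 - of_real s * z - of_real t * w + of_real (s * t) * z * w \<noteq> 0"
    if "cmod z < 1" "cmod w < 1" for z w
  proof -
    have "cmod (of_real s * z) < 1" "cmod (of_real t * w) < 1"
      using that st by (simp_all add: norm_mult)
    then have "1 - of_real s * z \<noteq> 0" "1 - of_real t * w \<noteq> 0"
      by auto
    then have "(1 - of_real s * z) * (1 - of_real t * w) \<noteq> 0"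
      by simp
    then show ?thesis
      by (simp add: algebra_simps)
  qed
  then have "(s, t, s * t) \<in> real_closed_tetrablock"
    unfolding real_closed_tetrablock_def using in_closure_tetrablock by simp
  moreover have "s * s = 1" "t * t = 1"
    using st by (metis abs_mult_self_eq mult_1)+
  then have "1 - s * s - t * t + s * t * (s * t) = 0"
    by (simp add: algebra_simps)
  ultimately have "(0, s, t, s * t) \<in> C_over (corner_face s t)"
    unfolding C_over_def corner_face_def by simp
  then show ?thesis
    by blast
qed

theorem proposition6p14:
  shows "(\<forall>\<Delta> \<in> {Delta1, Delta2, Delta3, Delta4}.
            extreme_subset (C_over \<Delta>) real_closed_hexablock) \<and>
         (\<forall>\<Delta> \<in> {Delta1, Delta2, Delta3, Delta4}.
            convex hull (C_over \<Delta>) \<noteq> {} \<and>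
            convex hull (C_over \<Delta>) face_of convex hull real_closed_hexablock)"
proof -
  have "extreme_subset (C_over (corner_face s t)) real_closed_hexablock \<and>
      convex hull (C_over (corner_face s t)) \<noteq> {} \<and>
      convex hull (C_over (corner_face s t)) face_of convex hull real_closed_hexablock"
    if st: "\<bar>s\<bar> = 1" "\<bar>t\<bar> = 1" for s t
  proof (intro conjI)
    show "extreme_subset (C_over (corner_face s t)) real_closed_hexablock"
      using C_over_corner_face_nonempty[OF st] real_closed_hexablock_supported[OF _ st]
      unfolding C_over_corner_face by (intro extreme_subset_supporting_hyperplane)
    show "convex hull (C_over (corner_face s t)) \<noteq> {}"
      using C_over_corner_face_nonempty[OF st] by simp
    show "convex hull (C_over (corner_face s t)) face_of convex hull real_closed_hexablock"
      unfolding C_over_corner_face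
      using real_closed_hexablock_supported[OF _ st]
      by (rule convex_hull_face_of_supporting_hyperplane)
  qed
  then show ?thesis
    unfolding Delta_eq_corner_face by simp
qed

end
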